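(* Let $m,n\ge 1$, let $T=(V_T,E_T)$ be any tree on $m$ vertices, let $v'$ be any vertex in $V_T$, and let $K$ be the complete graph on $n$ vertices. Then all orbits of toric promotion on the corona product $K\odot T(v')$ have length $(nm+n)(nm+n-1)$.
   Context: Toric promotion. Let $G=(V,E)$ be a finite simple graph (undirected, no loops, no multiple edges) on $N$ vertices. A labeling of $G$ is a bijection $\sigma:V\to\mathbb{Z}/N\mathbb{Z}=\{1,\dots,N\}$ (addition modulo $N$). A state is a pair $(\sigma,i)$ with $\sigma$ a labeling of $G$ and $i\in\mathbb{Z}/N\mathbb{Z}$; $\Omega_G$ is the set of all states. Toric promotion is the map $\mathrm{TPro}:\Omega_G\to\Omega_G$ given by $\mathrm{TPro}(\sigma,i)=(\sigma,i+1)$ if $\{\sigma^{-1}(i),\sigma^{-1}(i+1)\}\in E$, and $\mathrm{TPro}(\sigma,i)=((i,i+1)\circ\sigma,\,i+1)$ otherwise, where $(i,i+1)$ is the permutation of $\mathbb{Z}/N\mathbb{Z}$ swapping $i$ and $i+1$. It is a bijection of $\Omega_G$. The length of the orbit containing $(\sigma,i)$ is the least $L\ge 1$ with $\mathrm{TPro}^L(\sigma,i)=(\sigma,i)$. Corona product. Let $G_1=(V_1,E_1)$ and $G_2=(V_2,E_2)$ be graphs with $V_1=\{v_1,\dots,v_\nu\}$, and let $v'\in V_2$. The corona product $G_1\odot G_2(v')$ is the graph obtained from $G_1$ together with $\nu$ pairwise disjoint copies ${}^1G_2,\dots,{}^\nu G_2$ of $G_2$ (disjoint from $G_1$) by adding,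 for every $i\in\{1,\dots,\nu\}$, the edge $\{v_i,v'_i\}$, where $v'_i$ is the copy of $v'$ in ${}^iG_2$. *)

theory Defs
  imports
    "Graph_Theory.Pair_Digraph"
    "Graph_Theory.Digraph_Component"
    "Graph_Theory.Kuratowski"
    "HOL-Combinatorics.Transposition"
    "HOL-Library.FuncSet"
begin

(* Finite simple graphs are values satisfying pair_graph: finite, loop-free, symmetric, at most
   one arc per ordered pair.  The edge {u, v} is the pair of arcs (u, v), (v, u). *)

(* The constant forest is unsuitable for symmetric digraphs, since there u, v, u is a directed
   cycle; a cycle of the undirected graph is a directed cycle of length at least 3. *)
definition tree_graph :: "'a pair_pre_digraph \<Rightarrow> bool" where
  "tree_graph T \<longleftrightarrow>
     pair_graph T \<and> connected (with_proj T) \<and>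
     \<not> (\<exists>p. pre_digraph.cycle (with_proj T) p \<and> 3 \<le> length p)"

(* Inl x is the vertex x of G; Inr (x, w) is the vertex w in the copy of H attached to x. *)
definition corona ::
    "'a pair_pre_digraph \<Rightarrow> 'b pair_pre_digraph \<Rightarrow> 'b \<Rightarrow> ('a + 'a \<times> 'b) pair_pre_digraph" where
  "corona G H w = \<lparr>
     pverts = pverts G <+> (pverts G \<times> pverts H),
     parcs = {(Inl x, Inl y) | x y. (x, y) \<in> parcs G}
       \<union> {(Inr (x, u), Inr (x, v)) | x u v. x \<in> pverts G \<and> (u, v) \<in> parcs H}
       \<union> {(Inl x, Inr (x, w)) | x. x \<in> pverts G}
       \<union> {(Inr (x, w), Inl x) | x. x \<in> pverts G} \<rparr>"

(* Addition of 1 modulo N on the residues represented by 1, ..., N. *)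
definition cyc_suc :: "nat \<Rightarrow> nat \<Rightarrow> nat" where
  "cyc_suc N i = i mod N + 1"

(* Labelings are taken extensional, so that equality of functions is equality on the vertices. *)
definition labelings :: "'a pair_pre_digraph \<Rightarrow> ('a \<Rightarrow> nat) set" where
  "labelings G = {\<sigma> \<in> extensional (pverts G). bij_betw \<sigma> (pverts G) {1..card (pverts G)}}"

definition states :: "'a pair_pre_digraph \<Rightarrow> (('a \<Rightarrow> nat) \<times> nat) set" where
  "states G = labelings G \<times> {1..card (pverts G)}"

definition TPro :: "'a pair_pre_digraph \<Rightarrow> ('a \<Rightarrow> nat) \<times> nat \<Rightarrow> ('a \<Rightarrow> nat) \<times> nat" where
  "TPro G = (\<lambda>(\<sigma>, i).
     let j = cyc_suc (card (pverts G)) i in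
     if (inv_into (pverts G) \<sigma> i, inv_into (pverts G) \<sigma> j) \<in> parcs G
     then (\<sigma>, j)
     else (compose (pverts G) (transpose i j) \<sigma>, j))"

definition orbit_length :: "('s \<Rightarrow> 's) \<Rightarrow> 's \<Rightarrow> nat" where
  "orbit_length f s = (LEAST L. 1 \<le> L \<and> (f ^^ L) s = s)"

lemma pair_graph_corona:
  assumes "pair_graph G" "pair_graph H" "w \<in> pverts H"
  shows "pair_graph (corona G H w)"
proof -
  interpret G: pair_graph G by fact
  interpret H: pair_graph H by fact
  have fin: "finite (pverts (corona G H w))"
    by (simp add: corona_def G.pair_finite_verts H.pair_finite_verts)
  have sub: "parcs (corona G H w) \<subseteq> pverts (corona G H w) \<times> pverts (corona G H w)"
    using assms(3) by (auto simp: corona_def dest: G.in_arcsD1 G.in_arcsD2 H.in_arcsD1 H.in_arcsD2)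
  have sG: "(y, x) \<in> parcs G" if "(x, y) \<in> parcs G" for x y
    using G.arcs_symmetric that by simp
  have sH: "(y, x) \<in> parcs H" if "(x, y) \<in> parcs H" for x y
    using H.arcs_symmetric that by simp
  have "symmetric (with_proj (corona G H w))"
    by (auto simp: symmetric_def corona_def intro!: symI dest: sG sH)
  moreover have "fst e \<noteq> snd e" if "e \<in> parcs (corona G H w)" for e
    using that G.pair_no_loops H.pair_no_loops by (fastforce simp: corona_def)
  ultimately show ?thesis
    using fin sub by unfold_locales (auto intro: finite_subset)
qed

lemma card_corona:
  assumes "finite (pverts G)" "finite (pverts H)"
  shows "card (pverts (corona G H w)) = card (pverts G) * card (pverts H) + card (pverts G)"
  using assms by (simp add: corona_def card_Plus card_cartesian_product)

lemma cyc_suc_eq: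
  assumes "i \<in> {1..N}"
  shows "cyc_suc N i = (if i = N then 1 else i + 1)"
  using assms by (auto simp: cyc_suc_def)

lemma TPro_in_states:
  assumes "s \<in> states G"
  shows "TPro G s \<in> states G"
proof -
  let ?V = "pverts G" and ?N = "card (pverts G)"
  obtain \<sigma> i where s: "s = (\<sigma>, i)" by force
  define j where "j = cyc_suc ?N i"
  have i: "i \<in> {1..?N}" and \<sigma>: "\<sigma> \<in> labelings G"
    using assms by (auto simp: s states_def)
  have j: "j \<in> {1..?N}"
    using i by (auto simp: j_def cyc_suc_eq)
  have "bij_betw (transpose i j \<circ> \<sigma>) ?V {1..?N}"
  proof (rule bij_betw_trans)
    show "bij_betw \<sigma> ?V {1..?N}" using \<sigma> by (simp add: labelings_def)
    show "bij_betw (transpose i j) {1..?N} {1..?N}"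
      using i j by (intro bij_betw_imageI) auto
  qed
  then have "bij_betw (compose ?V (transpose i j) \<sigma>) ?V {1..?N}"
    by (rule bij_betw_cong[THEN iffD1, rotated]) (simp add: compose_def)
  then have "compose ?V (transpose i j) \<sigma> \<in> labelings G"
    by (simp add: labelings_def compose_def)
  then show ?thesis
    using \<sigma> j by (auto simp: TPro_def s states_def Let_def simp flip: j_def)
qed

end

theory Submission
  imports Defs "HOL-Combinatorics.Multiset_Permutations"
begin

text \<open>
  Read the vertices cyclically from the position i of a state: the first vertex is the carrier of
  a stone. One step of toric promotion lets the carrier walk past its successor if the two are not
  adjacent, and otherwise leaves the carrier behind in place of its successor, which takes over the
  stone. So N - 1 vertices stand on a circle of N - 1 spots, and at each step the carrier reaches
  the next spot.

  When the stone enters a rooted subtree with b vertices, by induction over the subtree it comes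
  back to the parent after exactly b (N - 1) steps with the subtree restored, as if the parent had
  walked past the root. Contracting these excursions leaves the motion of the stone on the complete
  graph, whose members always occupy the same spots and only shift cyclically. After n laps of this
  contracted motion everything is restored, and each core vertex has met the root of its own tree
  exactly once, so that the n (N - 1) contracted steps and the n excursions of length m (N - 1) add
  up to N (N - 1). The period cannot be smaller, because a chosen core vertex meets the root of
  its tree only once in that time.
\<close>

section \<open>Stone steps and excursions into trees\<close>

text \<open>The head of the list carries the stone; the rest stand on the spots, the next spot first.\<close>

fun stone_step :: "('a \<times> 'a) set \<Rightarrow> 'a list \<Rightarrow> 'a list" where
  "stone_step E (p # q # w) = (if (p, q) \<in> E then q # w @ [p] else p # w @ [q])"
| "stone_step E xs = xs"

lemma permutations_of_set_iff: "xs \<in> permutations_of_set V \<longleftrightarrow> set xs = V \<and> distinct xs"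
  by (auto simp: permutations_of_set_def)

lemma stone_step_in_permutations:
  "xs \<in> permutations_of_set V \<Longrightarrow> stone_step E xs \<in> permutations_of_set V"
  by (cases "(E, xs)" rule: stone_step.cases) (auto simp: permutations_of_set_iff)

lemma funpow_stone_step_in_permutations:
  "xs \<in> permutations_of_set V \<Longrightarrow> (stone_step E ^^ k) xs \<in> permutations_of_set V"
  by (induction k) (auto intro: stone_step_in_permutations)

lemma length_stone_step [simp]: "length (stone_step E xs) = length xs"
  by (cases "(E, xs)" rule: stone_step.cases) auto

text \<open>The first and last entries of the image are \<open>p\<close> and \<open>q\<close> in one
  order or the other. As \<open>E\<close> is symmetric, their adjacency reveals which case produced
  the list, so the step can be undone.\<close>

lemma stone_step_inject:
  assumes "sym E" "stone_step E xs = stone_step E ys"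
  shows "xs = ys"
proof -
  have "length xs = length ys"
    using assms(2) by (metis length_stone_step)
  then show ?thesis
    using assms
    by (cases "(E, xs)" rule: stone_step.cases; cases "(E, ys)" rule: stone_step.cases)
      (auto split: if_splits dest: symD)
qed

text \<open>Allows the least period to be determined at the most convenient list of an
  orbit.\<close>

lemma stone_step_period_transfer:
  assumes "sym E"
  shows "(stone_step E ^^ L) ((stone_step E ^^ j) xs) = (stone_step E ^^ j) xs
    \<longleftrightarrow> (stone_step E ^^ L) xs = xs"
proof -
  have "inj (stone_step E)"
    using assms by (auto intro: injI stone_step_inject)
  then have "inj (stone_step E ^^ j)"
    by (induction j) (auto intro: inj_compose)
  moreover have "(stone_step E ^^ L) ((stone_step E ^^ j) xs)
      = (stone_step E ^^ j) ((stone_step E ^^ L) xs)"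
    by (simp add: add.commute flip: comp_apply[of "_ ^^ _"] funpow_add)
  ultimately show ?thesis
    by (simp add: inj_eq)
qed

text \<open>The strict bound leaves the final list free to have its head outside \<open>D\<close>.
  Thus an excursion that ends at the parent is still confined to its branch.\<close>

definition stone_run ::
    "('a \<times> 'a) set \<Rightarrow> 'a set \<Rightarrow> nat \<Rightarrow> 'a list \<Rightarrow> 'a list \<Rightarrow> bool" where
  "stone_run E D L xs ys \<longleftrightarrow>
     (stone_step E ^^ L) xs = ys \<and> (\<forall>t<L. hd ((stone_step E ^^ t) xs) \<in> D)"

lemma stone_run_0: "stone_run E D 0 xs xs"
  by (simp add: stone_run_def)

lemma stone_run_1: "stone_step E xs = ys \<Longrightarrow> hd xs \<in> D \<Longrightarrow> stone_run E D 1 xs ys"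
  by (simp add: stone_run_def)

lemma stone_run_trans:
  assumes "stone_run E D a xs ys" "stone_run E D b ys zs"
  shows "stone_run E D (a + b) xs zs"
proof -
  have *: "(stone_step E ^^ (a + t)) xs = (stone_step E ^^ t) ys" for t
    using assms(1) by (simp add: stone_run_def add.commute[of a] funpow_add)
  have "hd ((stone_step E ^^ t) xs) \<in> D" if "t < a + b" for t
  proof (cases "t < a")
    case True
    then show ?thesis using assms(1) by (simp add: stone_run_def)
  next
    case False
    then show ?thesis
      using *[of "t - a"] that assms(2) by (simp add: stone_run_def)
  qed
  then show ?thesis
    using *[of b] assms(2) by (simp add: stone_run_def)
qed

lemma stone_run_mono: "stone_run E D L xs ys \<Longrightarrow> D \<subseteq> D' \<Longrightarrow> stone_run E D' L xs ys"
  by (auto simp: stone_run_def)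

text \<open>B is the vertex set of a subtree with root r, joined to the rest of the graph only by the edge
  between r and q.\<close>

inductive branch :: "('a \<times> 'a) set \<Rightarrow> 'a \<Rightarrow> 'a \<Rightarrow> 'a set \<Rightarrow> bool" for E where
  branchI: "finite C \<Longrightarrow> q \<notin> C \<Longrightarrow> (\<And>x. (r, x) \<in> E \<longleftrightarrow> x = q \<or> x \<in> C) \<Longrightarrow>
    (\<And>c. c \<in> C \<Longrightarrow> branch E r c (B c)) \<Longrightarrow> disjoint_family_on B C \<Longrightarrow>
    r \<notin> (\<Union>c\<in>C. B c) \<Longrightarrow> branch E q r (insert r (\<Union>c\<in>C. B c))"

lemma branch_root: "branch E q r B \<Longrightarrow> r \<in> B"
  by (auto elim: branch.cases)

lemma finite_branch: "branch E q r B \<Longrightarrow> finite B"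
  by (induction rule: branch.induct) auto

text \<open>The list \<open>r # w @ [q]\<close> arises when \<open>q\<close> hands the stone to
  \<open>r\<close> in \<open>q # r # w\<close>. The outcome \<open>q # w @ [r]\<close> is what one
  step would give if \<open>q\<close> and \<open>r\<close> were not adjacent.\<close>

definition excursion :: "('a \<times> 'a) set \<Rightarrow> 'a set \<Rightarrow> 'a \<Rightarrow> 'a \<Rightarrow> 'a set \<Rightarrow> bool" where
  "excursion E V q r B \<longleftrightarrow> (\<forall>w. r # w @ [q] \<in> permutations_of_set V \<longrightarrow>
     stone_run E B (card B * (card V - 1)) (r # w @ [q]) (q # w @ [r]))"

text \<open>A non-neighbour at the front of \<open>u\<close> is passed in one step. A child takes
  the stone, and its excursion ends with the child at the back, as if it had been passed. Both cases
  move the front of \<open>u\<close> to the back, so induction applies. The condition on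
  \<open>u\<close> excludes all neighbours but children, in particular the parent.\<close>

lemma stone_run_walk:
  assumes "r # u @ w \<in> permutations_of_set V" "set u \<inter> {x. (r, x) \<in> E} \<subseteq> C"
    "\<And>c. c \<in> C \<Longrightarrow> (r, c) \<in> E" "\<And>c. c \<in> C \<Longrightarrow> excursion E V r c (B c)"
  shows "stone_run E (insert r (\<Union>c\<in>C. B c))
    (length u + (\<Sum>c\<in>C \<inter> set u. card (B c) * (card V - 1))) (r # u @ w) (r # w @ u)"
  using assms(1,2)
proof (induction u arbitrary: w)
  case Nil
  then show ?case by (simp add: stone_run_0)
next
  case (Cons c u)
  let ?D = "insert r (\<Union>c\<in>C. B c)" and ?f = "\<lambda>c. card (B c) * (card V - 1)"
  have perm: "r # u @ (w @ [c]) \<in> permutations_of_set V"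
    using Cons.prems(1) by (auto simp: permutations_of_set_iff)
  have IH: "stone_run E ?D (length u + sum ?f (C \<inter> set u)) (r # u @ (w @ [c])) (r # (w @ [c]) @ u)"
    using Cons.prems by (intro Cons.IH perm) auto
  have cu: "c \<notin> set u"
    using Cons.prems by (auto simp: permutations_of_set_iff)
  show ?case
  proof (cases "c \<in> C")
    case True
    have 1: "stone_run E ?D 1 (r # c # u @ w) (c # (u @ w) @ [r])"
      using assms(3)[OF True] by (intro stone_run_1) auto
    have "c # (u @ w) @ [r] \<in> permutations_of_set V"
      using Cons.prems(1) by (auto simp: permutations_of_set_iff)
    then have "stone_run E (B c) (?f c) (c # (u @ w) @ [r]) (r # (u @ w) @ [c])"
      using assms(4)[OF True] unfolding excursion_def by blast
    then have 2: "stone_run E ?D (?f c) (c # (u @ w) @ [r]) (r # (u @ w) @ [c])"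
      by (rule stone_run_mono) (use True in auto)
    have "stone_run E ?D (1 + ?f c + (length u + sum ?f (C \<inter> set u)))
        (r # c # u @ w) (r # (w @ [c]) @ u)"
      using stone_run_trans[OF stone_run_trans[OF 1 2], of "length u + sum ?f (C \<inter> set u)"] IH
      by simp
    moreover have "C \<inter> set (c # u) = insert c (C \<inter> set u)"
      using True by auto
    ultimately show ?thesis
      using cu by (simp add: algebra_simps)
  next
    case False
    then have "(r, c) \<notin> E"
      using Cons.prems(2) by auto
    then have "stone_run E ?D 1 (r # c # u @ w) (r # u @ (w @ [c]))"
      by (intro stone_run_1) auto
    from stone_run_trans[OF this IH] show ?thesis
      using False by simp
  qed
qed

text \<open>The root passes all of \<open>w\<close>, which contains every child once, and then hands
  the stone to \<open>q\<close>. The passing steps and the last one make \<open>card V - 1\<close>;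
  the children add their own excursions, so each vertex of the branch accounts for
  \<open>card V - 1\<close> steps.\<close>

lemma excursion_branch:
  assumes "branch E q r B" "B \<subseteq> V"
  shows "excursion E V q r B"
  using assms
proof (induction rule: branch.induct)
  case (branchI C q r B)
  let ?D = "insert r (\<Union>c\<in>C. B c)" and ?M = "card V - 1"
  have exc: "excursion E V r c (B c)" if "c \<in> C" for c
    using branchI that by blast
  have CB: "c \<in> B c" if "c \<in> C" for c
    using branchI.hyps(4)[OF that] by (rule branch_root)
  have card_D: "card ?D = Suc (\<Sum>c\<in>C. card (B c))"
  proof -
    have "card (\<Union>c\<in>C. B c) = (\<Sum>c\<in>C. card (B c))"
      using branchI.hyps by (intro card_UN_disjoint') (auto dest: finite_branch)
    moreover have "finite (\<Union>c\<in>C. B c)"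
      using branchI.hyps by (auto dest: finite_branch)
    ultimately show ?thesis
      using branchI.hyps(6) by simp
  qed
  show ?case
    unfolding excursion_def
  proof (intro allI impI)
    fix w assume perm: "r # w @ [q] \<in> permutations_of_set V"
    have card_V: "card V - 1 = Suc (length w)"
      using perm by (auto simp: permutations_of_set_iff distinct_card[symmetric])
    have "C \<subseteq> set w"
    proof
      fix c assume c: "c \<in> C"
      then have "c \<in> set (r # w @ [q])"
        using CB branchI.prems perm by (auto simp: permutations_of_set_iff)
      moreover have "c \<noteq> r" "c \<noteq> q"
        using c CB branchI.hyps(2,6) by auto
      ultimately show "c \<in> set w" by auto
    qed
    then have "C \<inter> set w = C" by auto
    moreover have "stone_run E ?D (length w + (\<Sum>c\<in>C \<inter> set w. card (B c) * ?M))
        (r # w @ [q]) (r # [q] @ w)"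
      using perm exc branchI.hyps(3) by (intro stone_run_walk) (auto simp: permutations_of_set_iff)
    ultimately have 1: "stone_run E ?D (length w + (\<Sum>c\<in>C. card (B c)) * ?M)
        (r # w @ [q]) (r # [q] @ w)"
      by (simp add: sum_distrib_right)
    have 2: "stone_run E ?D 1 (r # [q] @ w) (q # w @ [r])"
      using branchI.hyps(3) by (intro stone_run_1) auto
    have "card ?D * ?M = length w + (\<Sum>c\<in>C. card (B c)) * ?M + 1"
      unfolding card_D card_V by simp
    with stone_run_trans[OF 1 2]
    show "stone_run E ?D (card ?D * ?M) (r # w @ [q]) (q # w @ [r])"
      by simp
  qed
qed

text \<open>A stone in the branch of a child reaches \<open>r\<close> by induction. Carried by
  \<open>r\<close>, it passes everything in front of \<open>q\<close> with finite excursions, and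
  the next step gives it to \<open>q\<close>.\<close>

lemma branch_climb:
  assumes "branch E q r B" "B \<subseteq> V" "q \<in> V" "q \<notin> B" "xs \<in> permutations_of_set V" "hd xs \<in> B"
  shows "\<exists>t. hd ((stone_step E ^^ t) xs) = q"
  using assms
proof (induction arbitrary: xs rule: branch.induct)
  case (branchI C q r B)
  have root: "\<exists>t. hd ((stone_step E ^^ t) xs) = q"
    if xs: "xs \<in> permutations_of_set V" "hd xs = r" for xs
  proof -
    obtain y where y: "xs = r # y"
      using xs branchI.prems by (cases xs) (auto simp: permutations_of_set_iff)
    then have "q \<in> set y"
      using xs branchI.prems by (auto simp: permutations_of_set_iff)
    then obtain u w where uw: "y = u @ q # w" "q \<notin> set u"
      by (meson split_list_first)
    have "stone_run E (insert r (\<Union>c\<in>C. B c))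
        (length u + (\<Sum>c\<in>C \<inter> set u. card (B c) * (card V - 1))) (r # u @ q # w) (r # (q # w) @ u)"
    proof (rule stone_run_walk)
      show "excursion E V r c (B c)" if "c \<in> C" for c
        using branchI that by (intro excursion_branch) auto
    qed (use xs y uw branchI.hyps(3) in auto)
    then have "(stone_step E ^^ (length u + (\<Sum>c\<in>C \<inter> set u. card (B c) * (card V - 1)))) xs
        = r # q # w @ u" (is "(_ ^^ ?L) _ = _")
      by (simp add: stone_run_def y uw)
    then have "hd ((stone_step E ^^ Suc ?L) xs) = q"
      using branchI.hyps(3) by simp
    then show ?thesis by blast
  qed
  show ?case
  proof (cases "hd xs = r")
    case True
    then show ?thesis using root branchI.prems by blast
  next
    case False
    then obtain c where c: "c \<in> C" "hd xs \<in> B c"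
      using branchI.prems by auto
    have "\<exists>t. hd ((stone_step E ^^ t) xs) = r"
      using c branchI.prems branchI.hyps(6) by (intro branchI.IH) auto
    then obtain t where "hd ((stone_step E ^^ t) xs) = r" by blast
    with root[OF funpow_stone_step_in_permutations[OF branchI.prems(4)]]
    show ?thesis
      by (metis comp_apply funpow_add)
  qed
qed

section \<open>The stone on a core with attached trees\<close>

text \<open>Given the other assumptions, \<open>card_V\<close> says that the branches are pairwise
  disjoint, in the form in which it enters the period.\<close>

locale core_branches =
  fixes E :: "('a \<times> 'a) set" and V K :: "'a set" and \<rho> :: "'a \<Rightarrow> 'a" and B :: "'a \<Rightarrow> 'a set"
    and m :: nat
  assumes finV: "finite V" and symE: "sym E" and K_ne: "K \<noteq> {}" and m_pos: "1 \<le> m"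
    and core_arc: "\<And>x y. x \<in> K \<Longrightarrow> (x, y) \<in> E \<longleftrightarrow> (y \<in> K \<and> y \<noteq> x) \<or> y = \<rho> x"
    and core_branch: "\<And>x. x \<in> K \<Longrightarrow> branch E x (\<rho> x) (B x)"
    and core_disjoint: "\<And>x. x \<in> K \<Longrightarrow> B x \<inter> K = {}"
    and card_core_branch: "\<And>x. x \<in> K \<Longrightarrow> card (B x) = m"
    and V_eq: "V = K \<union> (\<Union>x\<in>K. B x)"
    and card_V: "card V = card K * m + card K"
begin

abbreviation "n \<equiv> card K"
definition "M = card V - 1"

lemma finK: "finite K"
  using finV V_eq by simp

lemma n_pos: "1 \<le> n"
  using finK K_ne by (simp add: Suc_le_eq card_gt_0_iff)

lemma card_V_ge: "2 \<le> card V"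
  using card_V n_pos m_pos by (metis add_mono mult_le_mono nat_mult_1 one_add_one)

lemma M_pos: "1 \<le> M"
  using card_V_ge by (simp add: M_def)

lemma root_in_V: "x \<in> K \<Longrightarrow> \<rho> x \<in> V" and root_notin_K: "x \<in> K \<Longrightarrow> \<rho> x \<notin> K"
  using core_branch[of x] core_disjoint[of x] V_eq by (auto dest: branch_root)

lemma excursion_core: "x \<in> K \<Longrightarrow> excursion E V x (\<rho> x) (B x)"
  using core_branch V_eq by (intro excursion_branch) auto

lemma reaches_core:
  assumes "xs \<in> permutations_of_set V"
  shows "\<exists>t. hd ((stone_step E ^^ t) xs) \<in> K"
proof (cases "hd xs \<in> K")
  case True
  then show ?thesis by (intro exI[of _ 0]) simp
next
  case False
  have "xs \<noteq> []"
    using assms card_V_ge by (auto simp: permutations_of_set_iff)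
  then have "hd xs \<in> V"
    using assms by (auto simp: permutations_of_set_iff)
  then obtain x where x: "x \<in> K" "hd xs \<in> B x"
    using V_eq False by auto
  have "\<exists>t. hd ((stone_step E ^^ t) xs) = x"
    using branch_climb[OF core_branch[OF x(1)] _ _ _ assms x(2)] V_eq core_disjoint x(1) by blast
  then show ?thesis using x(1) by auto
qed

end

section \<open>The contracted motion of the stone on the core\<close>

locale core_run = core_branches +
  fixes p :: 'a and w :: "'a list"
  assumes p: "p \<in> K" and start: "p # w \<in> permutations_of_set V"
begin

text \<open>The contracted motion preserves the cyclic order of the core vertices, so the successive
  carriers are read off \<open>cs\<close> cyclically.\<close>

definition "cs = p # filter (\<lambda>x. x \<in> K) w"

text \<open>At contracted time t the carrier stands in front of spot t modulo M. The number core_count t of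
  core spots passed before is the number of changes of the carrier, so the carrier at time t is
  cs ! (core_count t mod n). The vertex on a core spot at time t was left there M steps earlier,
  hence it is the carrier with index core_count t - (n - 1), that is, core_count t + 1 modulo n.\<close>

definition "core_spot t \<longleftrightarrow> w ! (t mod M) \<in> K"

definition "core_count k = (\<Sum>t<k. of_bool (core_spot t) :: nat)"

definition "occupant t =
  (if core_spot t then cs ! ((core_count t + 1) mod n) else w ! (t mod M))"

text \<open>The predicted list after \<open>k\<close> contracted steps. Each spot is listed under
  the time of its next visit, hence the window of \<open>M\<close> consecutive times.\<close>

definition "config k = cs ! (core_count k mod n) # map occupant [k..<k + M]"

lemma length_w: "length w = M"
  using start by (auto simp: permutations_of_set_iff distinct_card[symmetric] M_def)

lemma distinct_cs: "distinct cs" and set_cs: "set cs = K"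
proof -
  have "set (p # w) = V"
    using start by (simp add: permutations_of_set_iff)
  then show "set cs = K"
    using p V_eq unfolding cs_def by auto
  show "distinct cs"
    using start by (simp add: cs_def permutations_of_set_iff)
qed

lemma length_cs: "length cs = n"
  using distinct_cs set_cs by (metis distinct_card)

lemma cs_in_K: "cs ! (i mod n) \<in> K"
  using n_pos set_cs length_cs by (metis mod_less_divisor nth_mem less_le_trans zero_less_one)

lemma core_spot_add [simp]: "core_spot (t + M) \<longleftrightarrow> core_spot t"
  by (simp add: core_spot_def)

lemma core_count_0 [simp]: "core_count 0 = 0"
  by (simp add: core_count_def)

lemma core_count_Suc: "core_count (Suc k) = core_count k + of_bool (core_spot k)"
  by (simp add: core_count_def)

lemma core_count_filter: "k \<le> M \<Longrightarrow> core_count k = length (filter (\<lambda>x. x \<in> K) (take k w))"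
proof (induction k)
  case 0
  then show ?case by simp
next
  case (Suc k)
  then show ?case
    using length_w by (simp add: core_count_Suc take_Suc_conv_app_nth core_spot_def)
qed

lemma core_count_M: "core_count M = n - 1"
  using core_count_filter[of M] length_w length_cs by (simp add: cs_def)

lemma core_count_add: "core_count (k + M) = core_count k + (n - 1)"
proof (induction k)
  case 0
  then show ?case by (simp add: core_count_M)
next
  case (Suc k)
  then show ?case
    using core_spot_add[of k] by (simp add: core_count_Suc)
qed

lemma core_count_add_mult: "core_count (k + l * M) = core_count k + l * (n - 1)"
proof (induction l)
  case (Suc l)
  have "core_count (k + Suc l * M) = core_count (k + l * M + M)"
    by (simp add: algebra_simps)
  then show ?case
    using Suc by (simp only: core_count_add) simp
qed simp

text \<open>As \<open>cs\<close> begins with \<open>p\<close>, the core vertex \<open>w ! t\<close>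
  has in \<open>cs\<close> an index one above the number of core entries of \<open>w\<close> before
  it. That index is below \<open>n\<close>, so the reduction modulo \<open>n\<close> does not change
  it.\<close>

lemma occupant_start: "t < M \<Longrightarrow> occupant t = w ! t"
proof (cases "core_spot t")
  case True
  assume t: "t < M"
  let ?f = "filter (\<lambda>x. x \<in> K)"
  have "w = take t w @ w ! t # drop (Suc t) w"
    using t length_w by (simp add: id_take_nth_drop)
  moreover have "w ! t \<in> K"
    using True t by (simp add: core_spot_def)
  ultimately have *: "?f w = ?f (take t w) @ w ! t # ?f (drop (Suc t) w)"
    by (metis filter.simps(2) filter_append)
  moreover have c: "core_count t = length (?f (take t w))"
    using t by (intro core_count_filter) simp
  ultimately have "cs ! (core_count t + 1) = w ! t"
    by (simp add: cs_def)
  moreover have "core_count t + 1 < n"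
    using * c length_cs by (simp add: cs_def)
  ultimately show ?thesis
    using True by (simp add: occupant_def)
next
  case False
  assume "t < M"
  with False show ?thesis
    by (simp add: occupant_def)
qed

lemma config_0: "config 0 = p # w"
proof -
  have "map occupant [0..<M] = w"
    using occupant_start length_w by (intro nth_equalityI) auto
  then show ?thesis
    using n_pos by (simp add: config_def core_count_def cs_def)
qed

text \<open>In \<open>n\<close> laps the carrier changes \<open>n * (n - 1)\<close> times, a
  multiple of \<open>n\<close>.\<close>

lemma config_period: "config (n * M) = config 0"
proof -
  have 1: "(core_count (t + n * M) + i) mod n = (core_count t + i) mod n" for t i
  proof -
    have "core_count (t + n * M) + i = core_count t + i + n * (n - 1)"
      by (simp add: core_count_add_mult)
    then show ?thesis by (simp only: mod_mult_self2)
  qed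
  have 2: "core_spot (t + n * M) = core_spot t" for t
    by (simp add: core_spot_def)
  have "occupant (t + n * M) = occupant t" for t
    by (simp only: occupant_def 1 2) simp
  moreover have "[n * M..<n * M + M] = map (\<lambda>t. t + n * M) [0..<M]"
    by (simp add: map_add_upt add.commute)
  ultimately show ?thesis
    using 1[of 0 0] by (simp add: config_def o_def)
qed

lemma config_decomp:
  obtains u where "config k = cs ! (core_count k mod n) # occupant k # u"
    "config (Suc k) = (if core_spot k
      then occupant k # u @ [cs ! (core_count k mod n)]
      else cs ! (core_count k mod n) # u @ [occupant k])"
proof -
  let ?u = "map occupant [Suc k..<k + M]"
  have 1: "[k..<k + M] = k # [Suc k..<k + M]" "[Suc k..<Suc k + M] = [Suc k..<k + M] @ [k + M]"
    using M_pos by (auto simp: upt_conv_Cons)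
  \<comment> \<open>One lap has \<open>n - 1\<close> changes of carrier; with the offset 1 in
    \<open>occupant\<close> they make a full turn. So the vertex met on a core spot one lap later is
    the present carrier, which is left there now.\<close>
  have "(core_count k + (n - 1) + 1) mod n = core_count k mod n"
    using n_pos by simp
  then have "occupant (k + M) = (if core_spot k then cs ! (core_count k mod n) else occupant k)"
    by (simp add: occupant_def core_count_add)
  moreover have "cs ! (core_count (Suc k) mod n) =
      (if core_spot k then occupant k else cs ! (core_count k mod n))"
    by (simp add: core_count_Suc occupant_def)
  ultimately show ?thesis
    by (intro that[of ?u]) (auto simp only: config_def 1 list.map map_append split: if_splits)
qed

lemma occupant_in_K: "occupant k \<in> K \<longleftrightarrow> core_spot k"
  using cs_in_K by (simp add: occupant_def core_spot_def)

definition "meets k x \<longleftrightarrow> cs ! (core_count k mod n) = x \<and> occupant k = \<rho> x"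

text \<open>The number of stone steps in contracted step \<open>k\<close>. At its own root the
  carrier hands over the stone, and the excursion takes \<open>M\<close> steps for each of the
  \<open>m\<close> tree vertices.\<close>

definition "cost k = (if \<exists>x\<in>K. meets k x then 1 + m * M else 1)"

text \<open>The carrier faces a core vertex, its own root, or a tree vertex that is not adjacent to
  it; only the second case takes more than one step. The second conjunct serves the lower bound on
  the period: no core vertex holds the stone inside a contracted step.\<close>

lemma stone_run_config_Suc:
  assumes "config k \<in> permutations_of_set V"
  shows "stone_run E UNIV (cost k) (config k) (config (Suc k)) \<and>
    (\<forall>t. 0 < t \<longrightarrow> t < cost k \<longrightarrow> hd ((stone_step E ^^ t) (config k)) \<notin> K)"
proof -
  define a where "a = cs ! (core_count k mod n)"
  define b where "b = occupant k"
  obtain u where u: "config k = a # b # u"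
    "config (Suc k) = (if core_spot k then b # u @ [a] else a # u @ [b])"
    unfolding a_def b_def by (rule config_decomp)
  have a: "a \<in> K"
    by (simp add: a_def cs_in_K)
  have ab: "a \<noteq> b" and perm: "b # u @ [a] \<in> permutations_of_set V"
    using assms by (auto simp: u permutations_of_set_iff)
  have meets: "(\<exists>x\<in>K. meets k x) \<longleftrightarrow> b = \<rho> a"
    using a by (auto simp: meets_def a_def b_def)
  consider "core_spot k" | "\<not> core_spot k" "b = \<rho> a" | "\<not> core_spot k" "b \<noteq> \<rho> a"
    by blast
  then show ?thesis
  proof cases
    case 1
    then have "b \<in> K"
      by (simp add: b_def occupant_in_K)
    then have "cost k = 1" "(a, b) \<in> E"
      using a ab root_notin_K[OF a] by (auto simp: cost_def meets core_arc)
    then show ?thesis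
      using 1 by (auto simp: u stone_run_def)
  next
    case 2
    then have ab: "(a, b) \<in> E" and cost: "cost k = 1 + m * M"
      using a by (auto simp: cost_def meets core_arc)
    have 1: "stone_step E (config k) = b # u @ [a]"
      using ab by (simp add: u)
    have 2: "stone_run E (B a) (m * M) (b # u @ [a]) (config (Suc k))"
      using excursion_core[OF a] perm 2 card_core_branch[OF a]
      unfolding excursion_def by (simp add: u M_def)
    have "hd ((stone_step E ^^ t) (config k)) \<notin> K" if t: "0 < t" "t < cost k" for t
    proof -
      obtain t' where t': "t = Suc t'" using t(1) gr0_implies_Suc by blast
      then have "hd ((stone_step E ^^ t') (b # u @ [a])) \<in> B a"
        using 2 t(2) by (simp add: stone_run_def cost)
      then show ?thesis
        using core_disjoint[OF a] by (auto simp: t' 1 funpow_Suc_right simp del: funpow.simps)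
    qed
    moreover have "stone_run E UNIV (1 + m * M) (config k) (config (Suc k))"
      using 1 stone_run_mono[OF 2, of UNIV] by (intro stone_run_trans[OF stone_run_1]) auto
    ultimately show ?thesis
      by (simp add: cost)
  next
    case 3
    then have "b \<notin> K"
      by (simp add: b_def occupant_in_K)
    then have "cost k = 1" "(a, b) \<notin> E"
      using a 3 by (auto simp: cost_def meets core_arc)
    then show ?thesis
      using 3 by (auto simp: u stone_run_def)
  qed
qed

section \<open>Contracted steps measured in stone steps, and the return time\<close>

definition "time k = (\<Sum>t<k. cost t)"

lemma time_Suc: "time (Suc k) = time k + cost k"
  by (simp add: time_def)

lemma stone_step_time: "(stone_step E ^^ time k) (p # w) = config k"
proof (induction k)
  case 0
  then show ?case by (simp add: time_def config_0)
next
  case (Suc k)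
  then have "config k \<in> permutations_of_set V"
    using start by (metis funpow_stone_step_in_permutations)
  then have "(stone_step E ^^ cost k) (config k) = config (Suc k)"
    using stone_run_config_Suc by (simp add: stone_run_def)
  then show ?case
    using Suc by (simp add: time_Suc add.commute[of "time k"] funpow_add)
qed

lemma between_times:
  assumes "time k < t" "t < time (Suc k)"
  shows "hd ((stone_step E ^^ t) (p # w)) \<notin> K"
proof -
  have "config k \<in> permutations_of_set V"
    using start by (metis funpow_stone_step_in_permutations stone_step_time)
  then have "hd ((stone_step E ^^ (t - time k)) (config k)) \<notin> K"
    using stone_run_config_Suc[of k] assms by (auto simp: time_Suc)
  moreover have "(stone_step E ^^ (t - time k + time k)) (p # w)
      = (stone_step E ^^ (t - time k)) (config k)"
    unfolding funpow_add by (simp add: stone_step_time)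
  then have "(stone_step E ^^ (t - time k)) (config k) = (stone_step E ^^ t) (p # w)"
    using assms(1) by simp
  ultimately show ?thesis by simp
qed

text \<open>In the contracted motion the root of \<open>x\<close> stays on one spot, which is
  visited once per lap. Each lap lowers the carrier index there by one modulo \<open>n\<close>, so
  in \<open>n\<close> laps every core vertex comes by exactly once.\<close>

lemma ex1_meets:
  assumes "x \<in> K"
  shows "\<exists>!k. k < n * M \<and> meets k x"
proof -
  have "\<rho> x \<in> set w"
    using assms p start root_in_V root_notin_K by (auto simp: permutations_of_set_iff)
  then obtain s where s: "s < M" "w ! s = \<rho> x"
    by (metis in_set_conv_nth length_w)
  have ns: "\<not> core_spot s"
    using s root_notin_K[OF assms] by (simp add: core_spot_def)
  have meets: "meets k x \<longleftrightarrow> k mod M = s \<and> cs ! (core_count k mod n) = x" for k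
  proof -
    have "occupant k = \<rho> x \<longleftrightarrow> k mod M = s"
    proof
      assume k: "occupant k = \<rho> x"
      then have "\<not> core_spot k"
        using root_notin_K[OF assms] by (simp flip: occupant_in_K)
      then have "w ! (k mod M) = w ! s"
        using k s by (simp add: occupant_def)
      moreover have "distinct w" "k mod M < M"
        using start M_pos by (auto simp: permutations_of_set_iff)
      ultimately show "k mod M = s"
        using s length_w by (metis nth_eq_iff_index_eq)
    next
      assume "k mod M = s"
      then show "occupant k = \<rho> x"
        using ns s by (simp add: occupant_def core_spot_def)
    qed
    then show ?thesis by (auto simp: meets_def)
  qed
  obtain i where i: "i < n" "cs ! i = x"
    using assms by (metis in_set_conv_nth length_cs set_cs)
  have idx: "cs ! (j mod n) = x \<longleftrightarrow> j mod n = i" for j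
    using i n_pos length_cs distinct_cs
    by (metis mod_less_divisor nth_eq_iff_index_eq less_le_trans zero_less_one)
  let ?c = "core_count s"
  \<comment> \<open>The n visits to spot s within one period find carriers number ?c - l modulo n.\<close>
  have visit: "meets (s + l * M) x \<longleftrightarrow> (?c + l * (n - 1)) mod n = i" for l
    using s(1) by (simp add: meets core_count_add_mult idx)
  have cong: "(?c + l * (n - 1)) mod n = i \<longleftrightarrow> (int ?c - int l) mod int n = int i" for l
  proof -
    have "int (n - 1) = int n - 1"
      using n_pos by simp
    then have "int (?c + l * (n - 1)) = int ?c - int l + int l * int n"
      unfolding of_nat_add of_nat_mult by (simp only:) (simp add: algebra_simps)
    then have "int ((?c + l * (n - 1)) mod n) = (int ?c - int l) mod int n"
      by (simp only: zmod_int mod_mult_self1)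
    then show ?thesis by (simp flip: of_nat_eq_iff[where 'a = int])
  qed
  \<comment> \<open>The lap in which the carrier index at spot \<open>s\<close> equals
    \<open>i\<close>, the index of \<open>x\<close>.\<close>
  define l where "l = nat ((int ?c - int i) mod int n)"
  have l: "int l = (int ?c - int i) mod int n" "l < n"
    using n_pos by (auto simp: l_def nat_less_iff)
  have "(int ?c - int l) mod int n = (int ?c - (int ?c - int i)) mod int n"
    unfolding l(1) by (simp add: mod_diff_right_eq)
  then have "(int ?c - int l) mod int n = int i"
    using i(1) by simp
  then have ml: "meets (s + l * M) x"
    by (simp only: visit cong)
  have less: "s + l * M < n * M"
  proof -
    have "s + l * M < (l + 1) * M" using s(1) by simp
    also have "\<dots> \<le> n * M" using l(2) by (intro mult_le_mono) auto
    finally show ?thesis .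
  qed
  show ?thesis
  proof (rule ex1I[of _ "s + l * M"])
    fix k assume k: "k < n * M \<and> meets k x"
    define l' where "l' = k div M"
    have k_eq: "k = s + l' * M"
      using k by (auto simp: l'_def meets)
    have l': "l' < n"
      using k M_pos by (simp add: l'_def less_mult_imp_div_less)
    have "(int ?c - int l') mod int n = (int ?c - int l) mod int n"
      using k ml unfolding k_eq visit cong by simp
    then have "(int ?c - (int ?c - int l')) mod int n = (int ?c - (int ?c - int l)) mod int n"
      by (rule mod_diff_cong[OF refl])
    then have "l' = l"
      using l' l(2) by simp
    then show "k = s + l * M" by (simp add: k_eq)
  qed (use ml less in auto)
qed

text \<open>By \<open>ex1_meets\<close> the contracted steps with an excursion correspond
  bijectively to the core vertices, so exactly \<open>n\<close> of the \<open>n * M\<close> steps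
  cost an extra \<open>m * M\<close>.\<close>

lemma time_period: "time (n * M) = card V * M"
proof -
  let ?S = "{k. k < n * M \<and> (\<exists>x\<in>K. meets k x)}"
  have "bij_betw (\<lambda>k. cs ! (core_count k mod n)) ?S K"
    unfolding bij_betw_def
  proof
    show "inj_on (\<lambda>k. cs ! (core_count k mod n)) ?S"
    proof (rule inj_onI)
      fix k k' assume "k \<in> ?S" "k' \<in> ?S"
        "cs ! (core_count k mod n) = cs ! (core_count k' mod n)"
      then show "k = k'"
        using ex1_meets[OF cs_in_K[of "core_count k"]] by (auto simp: meets_def)
    qed
    show "(\<lambda>k. cs ! (core_count k mod n)) ` ?S = K"
    proof (intro equalityI subsetI)
      fix x assume x: "x \<in> K"
      then obtain k where "k < n * M" "meets k x"
        using ex1_meets by blast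
      with x show "x \<in> (\<lambda>k. cs ! (core_count k mod n)) ` ?S"
        by (auto simp: meets_def intro!: image_eqI[of _ _ k])
    qed (use cs_in_K in auto)
  qed
  then have card_S: "card ?S = n"
    by (rule bij_betw_same_card)
  have "time (n * M) = (\<Sum>k<n * M. 1 + (if k \<in> ?S then m * M else 0))"
    unfolding time_def by (intro sum.cong) (auto simp: cost_def)
  also have "\<dots> = n * M + (\<Sum>k<n * M. if k \<in> ?S then m * M else 0)"
    by (subst sum.distrib) simp
  also have "(\<Sum>k<n * M. if k \<in> ?S then m * M else 0) = card ?S * (m * M)"
    by (subst sum.inter_filter[symmetric]) (auto intro!: arg_cong[of _ _ card])
  finally have "time (n * M) = n * M + n * (m * M)"
    by (simp only: card_S)
  then show ?thesis
    by (simp add: card_V algebra_simps)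
qed

lemma stone_step_period: "(stone_step E ^^ (card V * M)) (p # w) = p # w"
  using stone_step_time[of "n * M"] config_period by (simp add: config_0 time_period)

text \<open>At a return the core vertex \<open>p\<close> holds the stone, so \<open>L\<close> is the
  end of a contracted step. There \<open>p\<close> would meet its root again, but within the period
  it does so only at contracted time 0.\<close>

lemma stone_step_return:
  assumes "w \<noteq> []" "hd w = \<rho> p" "1 \<le> L" "(stone_step E ^^ L) (p # w) = p # w"
  shows "card V * M \<le> L"
proof (rule ccontr)
  assume "\<not> card V * M \<le> L"
  then have less: "L < time (n * M)"
    by (simp add: time_period)
  \<comment> \<open>The contracted step during which time \<open>L\<close> falls. The maximum exists
    because every contracted step costs at least 1.\<close>
  define k where "k = (GREATEST k. time k \<le> L)"
  have time_ge: "k \<le> time k" for k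
    by (induction k) (auto simp: time_def cost_def)
  have k: "time k \<le> L"
    unfolding k_def by (rule GreatestI_nat[of _ 0 L]) (use time_ge in \<open>auto simp: time_def intro: le_trans\<close>)
  have "k' \<le> k" if "time k' \<le> L" for k'
    unfolding k_def by (rule Greatest_le_nat[of _ _ L]) (use time_ge that in \<open>auto intro: le_trans\<close>)
  then have Suc_k: "L < time (Suc k)"
    by (metis Suc_n_not_le_n not_le)
  have "time i \<le> time j" if "i \<le> j" for i j
    using that unfolding time_def by (intro sum_mono2) auto
  then have k_less: "k < n * M"
    using k less by (meson le_less_trans not_le)
  show False
  proof (cases "L = time k")
    case True
    then have config_k: "config k = p # w"
      using assms(4) by (simp add: stone_step_time)
    obtain u where "config k = cs ! (core_count k mod n) # occupant k # u"
      by (rule config_decomp)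
    then have "meets k p"
      using assms(2) unfolding config_k meets_def by (metis list.inject list.sel(1))
    moreover have "meets 0 p"
    proof -
      obtain u where "config 0 = cs ! (core_count 0 mod n) # occupant 0 # u"
        by (rule config_decomp)
      then show ?thesis
        using assms(2) unfolding config_0 meets_def by (metis list.inject list.sel(1))
    qed
    ultimately have "k = 0"
      using ex1_meets[OF p] k_less by (metis gr_zeroI less_zeroE)
    then show False
      using True assms(3) by (simp add: time_def)
  next
    case False
    then have "hd ((stone_step E ^^ L) (p # w)) \<notin> K"
      using k Suc_k by (intro between_times) auto
    then show False
      using p assms(4) by simp
  qed
qed

text \<open>Provides a list on the orbit that has the special form required by
  \<open>stone_step_return\<close>.\<close>

lemma reaches_meeting: "\<exists>t u. (stone_step E ^^ t) (p # w) = p # \<rho> p # u"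
proof -
  obtain k where "meets k p"
    using ex1_meets[OF p] by blast
  moreover obtain u where "config k = cs ! (core_count k mod n) # occupant k # u"
    by (rule config_decomp)
  ultimately have "(stone_step E ^^ time k) (p # w) = p # \<rho> p # u"
    by (simp add: stone_step_time meets_def)
  then show ?thesis by blast
qed

end

context core_branches
begin

text \<open>The orbit is followed first to a core carrier and from there to a carrier facing its own
  root. The period found at that list is carried back to \<open>xs\<close>.\<close>

lemma stone_step_least_period:
  assumes xs: "xs \<in> permutations_of_set V"
  shows "(stone_step E ^^ (card V * (card V - 1))) xs = xs"
    and "1 \<le> L \<Longrightarrow> (stone_step E ^^ L) xs = xs \<Longrightarrow> card V * (card V - 1) \<le> L"
proof -
  obtain s where s: "hd ((stone_step E ^^ s) xs) \<in> K"
    using reaches_core[OF xs] by blast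
  have perm: "(stone_step E ^^ s) xs \<in> permutations_of_set V"
    using xs by (rule funpow_stone_step_in_permutations)
  obtain p w where pw: "(stone_step E ^^ s) xs = p # w"
    using perm card_V_ge by (cases "(stone_step E ^^ s) xs") (auto simp: permutations_of_set_iff)
  interpret run: core_run E V K \<rho> B m p w
    using s perm by unfold_locales (auto simp: pw)
  obtain t u where tu: "(stone_step E ^^ t) (p # w) = p # \<rho> p # u"
    using run.reaches_meeting by blast
  interpret meeting: core_run E V K \<rho> B m p "\<rho> p # u"
    using run.p funpow_stone_step_in_permutations[OF run.start] by unfold_locales (auto simp flip: tu)
  have start: "(stone_step E ^^ (t + s)) xs = p # \<rho> p # u"
    by (simp add: funpow_add pw tu)
  note period = stone_step_period_transfer[OF symE, of _ "t + s" xs, unfolded start]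
  show "(stone_step E ^^ (card V * (card V - 1))) xs = xs"
    using meeting.stone_step_period period by (simp add: M_def)
  show "card V * (card V - 1) \<le> L" if "1 \<le> L" "(stone_step E ^^ L) xs = xs"
    using meeting.stone_step_return[of L] period that by (simp add: M_def)
qed

end

section \<open>Toric promotion as stone steps\<close>

text \<open>xs lists the vertices at the positions i, i + 1, ... in cyclic order, for s = (\<sigma>, i).\<close>

definition represents :: "'a pair_pre_digraph \<Rightarrow> ('a \<Rightarrow> nat) \<times> nat \<Rightarrow> 'a list \<Rightarrow> bool" where
  "represents G s xs \<longleftrightarrow> xs \<in> permutations_of_set (pverts G) \<and>
     (\<forall>k<length xs. fst s (xs ! k) = (snd s - 1 + k) mod card (pverts G) + 1)"

lemma length_represents: "represents G s xs \<Longrightarrow> length xs = card (pverts G)"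
  by (auto simp: represents_def permutations_of_set_iff distinct_card[symmetric])

lemma ex_represents:
  assumes "s \<in> states G"
  shows "\<exists>xs. represents G s xs"
proof -
  define V N \<sigma> i where "V = pverts G" "N = card V" "\<sigma> = fst s" "i = snd s"
  note defs = this
  have i: "1 \<le> i" "i \<le> N" and \<sigma>: "bij_betw \<sigma> V {1..N}"
    using assms by (auto simp: defs states_def labelings_def)
  define label where "label k = (i - 1 + k) mod N + 1" for k
  define xs where "xs = map (\<lambda>k. inv_into V \<sigma> (label k)) [0..<N]"
  have label_in: "label k \<in> {1..N}" for k
    using i by (simp add: label_def Suc_le_eq)
  have "set xs = V"
  proof
    show "set xs \<subseteq> V"
      using label_in \<sigma> by (auto simp: xs_def bij_betw_def intro!: inv_into_into)
    show "V \<subseteq> set xs"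
    proof
      fix v assume v: "v \<in> V"
      then have j: "1 \<le> \<sigma> v" "\<sigma> v \<le> N"
        using \<sigma> by (auto simp: bij_betw_def)
      \<comment> \<open>The distance from position \<open>i\<close> on to the label of
        \<open>v\<close>; adding \<open>N\<close> avoids truncated subtraction.\<close>
      define k where "k = (\<sigma> v + N - i) mod N"
      have "label k = (i - 1 + (\<sigma> v + N - i)) mod N + 1"
        by (simp add: label_def k_def mod_add_right_eq)
      also have "i - 1 + (\<sigma> v + N - i) = (\<sigma> v - 1) + N"
        using i j by simp
      finally have "label k = (\<sigma> v - 1) mod N + 1"
        by (simp only: mod_add_self2)
      then have "label k = \<sigma> v"
        using j by simp
      then have "inv_into V \<sigma> (label k) = v"
        using v \<sigma> by (simp add: bij_betw_def)
      moreover have "k < N"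
        using i by (simp add: k_def)
      ultimately show "v \<in> set xs"
        by (auto simp: xs_def)
    qed
  qed
  moreover from this have "distinct xs"
    by (intro card_distinct) (simp add: xs_def defs)
  moreover have "\<sigma> (xs ! k) = label k" if "k < N" for k
    using that label_in \<sigma> by (simp add: xs_def bij_betw_inv_into_right)
  ultimately have "represents G s xs"
    by (simp add: represents_def permutations_of_set_iff defs label_def) (simp add: xs_def defs)
  then show ?thesis by blast
qed

text \<open>The reading now starts at \<open>j\<close>, and position \<open>i\<close> comes last. If
  the labels stay, \<open>q\<close> is first and \<open>p\<close> last; if they are swapped,
  \<open>p\<close> is first and \<open>q\<close> last.\<close>

lemma represents_TPro:
  assumes s: "s \<in> states G" and rep: "represents G s xs" and N: "2 \<le> card (pverts G)"
  shows "represents G (TPro G s) (stone_step (parcs G) xs)"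
proof -
  define V N \<sigma> i j where "V = pverts G" "N = card V" "\<sigma> = fst s" "i = snd s" "j = cyc_suc N i"
  note defs = this
  have i: "1 \<le> i" "i \<le> N" and inj: "inj_on \<sigma> V"
    using s by (auto simp: defs states_def labelings_def bij_betw_def)
  have len: "length xs = N"
    using length_represents[OF rep] by (simp add: defs)
  then obtain p q w where xs: "xs = p # q # w"
    using N by (metis One_nat_def Suc_1 Suc_le_length_iff defs(1,2))
  have perm: "set xs = V" "distinct xs"
    using rep by (auto simp: represents_def permutations_of_set_iff defs)
  have lab: "\<sigma> (xs ! k) = (i - 1 + k) mod N + 1" if "k < N" for k
    using rep that len by (simp add: represents_def defs)
  have p: "\<sigma> p = i" and q: "\<sigma> q = j"
    using lab[of 0] lab[of 1] i N by (auto simp: xs defs cyc_suc_def)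
  have inv: "inv_into V \<sigma> i = p" "inv_into V \<sigma> j = q"
    using inj perm by (auto simp: xs simp flip: p q intro!: inv_into_f_f)
  have j: "j = i mod N + 1"
    by (simp add: defs(5) cyc_suc_def)
  \<comment> \<open>The last of the \<open>N\<close> positions read from \<open>j\<close> on is
    \<open>i\<close>.\<close>
  have i_shift: "(i mod N + (N - 1)) mod N + 1 = i"
  proof -
    have "(i mod N + (N - 1)) mod N = (i + (N - 1)) mod N"
      by (simp add: mod_add_left_eq)
    also have "i + (N - 1) = (i - 1) + N"
      using i by simp
    finally have "(i mod N + (N - 1)) mod N = (i - 1) mod N"
      by (simp only: mod_add_self2)
    then show ?thesis using i by simp
  qed
  have w: "\<sigma> (w ! k) = (i mod N + Suc k) mod N + 1" "w ! k \<in> V" "w ! k \<noteq> p" "w ! k \<noteq> q"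
    if "k < length w" for k
  proof -
    show "\<sigma> (w ! k) = (i mod N + Suc k) mod N + 1"
    proof -
      have "i - 1 + Suc (Suc k) = i + Suc k" using i by simp
      then show ?thesis
        using lab[of "Suc (Suc k)"] that len by (simp only: mod_add_left_eq) (simp add: xs)
    qed
    have "w ! k \<in> set w" using that by simp
    then show "w ! k \<in> V" "w ! k \<noteq> p" "w ! k \<noteq> q"
      using perm by (auto simp: xs)
  qed
  have len_w: "N = Suc (Suc (length w))"
    using len by (simp add: xs)
  have perm': "stone_step (parcs G) xs \<in> permutations_of_set V"
    using rep by (simp add: represents_def defs stone_step_in_permutations)
  have rep_iff: "represents G (\<tau>, j) ys \<longleftrightarrow> ys \<in> permutations_of_set V \<and>
      (\<forall>k<length ys. \<tau> (ys ! k) = (i mod N + k) mod N + 1)" for \<tau> ys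
    by (simp add: represents_def j defs(1,2))
  show ?thesis
  proof (cases "(p, q) \<in> parcs G")
    case True
    have TPro: "TPro G s = (\<sigma>, j)"
      using True inv by (simp add: TPro_def Let_def defs case_prod_beta)
    have "\<sigma> ((q # w @ [p]) ! k) = (i mod N + k) mod N + 1" if "k < N" for k
    proof -
      consider "k = 0" | k' where "k = Suc k'" "k' < length w" | "k = Suc (length w)"
        using \<open>k < N\<close> len_w by (cases k) (auto simp: less_Suc_eq)
      then show ?thesis
      proof cases
        case 1
        then show ?thesis by (simp add: q j)
      next
        case (2 k')
        then show ?thesis using w(1)[of k'] by (simp add: nth_append)
      next
        case 3
        then show ?thesis using i_shift by (simp add: nth_append p len_w)
      qed
    qed
    then show ?thesis
      using perm' True by (simp add: TPro rep_iff xs len_w)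
  next
    case False
    have TPro: "TPro G s = (compose V (transpose i j) \<sigma>, j)"
      using False inv by (simp add: TPro_def Let_def defs case_prod_beta)
    have "compose V (transpose i j) \<sigma> ((p # w @ [q]) ! k) = (i mod N + k) mod N + 1"
      if "k < N" for k
    proof -
      have pq: "p \<in> V" "q \<in> V" using perm by (auto simp: xs)
      consider "k = 0" | k' where "k = Suc k'" "k' < length w" | "k = Suc (length w)"
        using \<open>k < N\<close> len_w by (cases k) (auto simp: less_Suc_eq)
      then show ?thesis
      proof cases
        case 1
        then show ?thesis using pq by (simp add: p j compose_def)
      next
        case (2 k')
        have "\<sigma> (w ! k') \<noteq> \<sigma> p" "\<sigma> (w ! k') \<noteq> \<sigma> q"
          using w(2-4)[OF 2(2)] pq inj by (auto dest: inj_onD)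
        then have "\<sigma> (w ! k') \<noteq> i" "\<sigma> (w ! k') \<noteq> j"
          by (simp_all add: p q)
        then show ?thesis using w[OF 2(2)] 2 by (simp add: nth_append compose_def)
      next
        case 3
        then show ?thesis using i_shift pq by (simp add: nth_append q compose_def len_w)
      qed
    qed
    then show ?thesis
      using perm' False by (simp add: TPro rep_iff xs len_w)
  qed
qed

lemma represents_funpow_TPro:
  assumes "s \<in> states G" "represents G s xs" "2 \<le> card (pverts G)"
  shows "(TPro G ^^ L) s \<in> states G \<and>
    represents G ((TPro G ^^ L) s) ((stone_step (parcs G) ^^ L) xs)"
  using assms by (induction L) (auto intro: TPro_in_states represents_TPro)

lemma snd_funpow_TPro:
  assumes "s \<in> states G"
  shows "snd ((TPro G ^^ L) s) = (snd s - 1 + L) mod card (pverts G) + 1"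
proof (induction L)
  case 0
  then show ?case using assms by (auto simp: states_def)
next
  case (Suc L)
  have "snd (TPro G s') = snd s' mod card (pverts G) + 1" for s'
    by (simp add: TPro_def case_prod_beta Let_def cyc_suc_def)
  then show ?case
    using Suc by (simp add: mod_Suc_eq)
qed

lemma represents_unique_list:
  assumes "s \<in> states G" "represents G s xs" "represents G s ys"
  shows "xs = ys"
proof (rule nth_equalityI)
  show len: "length xs = length ys"
    using assms by (simp add: length_represents)
  fix k assume k: "k < length xs"
  then have "xs ! k \<in> pverts G" "ys ! k \<in> pverts G"
    using assms len by (auto simp: represents_def permutations_of_set_iff)
  moreover have "fst s (xs ! k) = fst s (ys ! k)"
    using assms k len by (simp add: represents_def)
  ultimately show "xs ! k = ys ! k"
    using assms(1) by (auto simp: states_def labelings_def bij_betw_def inj_on_def)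
qed

lemma represents_unique_state:
  assumes "s \<in> states G" "s' \<in> states G" "represents G s xs" "represents G s' xs" "snd s = snd s'"
  shows "s = s'"
proof -
  have "fst s v = fst s' v" for v
  proof (cases "v \<in> pverts G")
    case True
    then obtain k where "k < length xs" "xs ! k = v"
      using assms(3) by (metis in_set_conv_nth permutations_of_setD(1) represents_def)
    then show ?thesis
      using assms(3-5) by (auto simp: represents_def)
  next
    case False
    then show ?thesis
      using assms(1,2) by (auto simp: states_def labelings_def extensional_def)
  qed
  then show ?thesis
    using assms(5) by (simp add: prod_eq_iff fun_eq_iff)
qed

text \<open>A list fixes the state only together with the position, so
  \<open>card (pverts G) dvd P\<close> is what brings the position back as well. Conversely, a
  returning state forces its list to return.\<close>

lemma orbit_length_TPro:
  assumes s: "s \<in> states G" and N: "2 \<le> card (pverts G)"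
    and P: "1 \<le> P" "card (pverts G) dvd P"
    and period: "\<And>xs. xs \<in> permutations_of_set (pverts G) \<Longrightarrow> (stone_step (parcs G) ^^ P) xs = xs"
    and least: "\<And>xs L. xs \<in> permutations_of_set (pverts G) \<Longrightarrow> 1 \<le> L \<Longrightarrow>
      (stone_step (parcs G) ^^ L) xs = xs \<Longrightarrow> P \<le> L"
  shows "orbit_length (TPro G) s = P"
proof -
  obtain xs where rep: "represents G s xs"
    using ex_represents[OF s] by blast
  then have perm: "xs \<in> permutations_of_set (pverts G)"
    by (simp add: represents_def)
  note run = represents_funpow_TPro[OF s rep N]
  show ?thesis
    unfolding orbit_length_def
  proof (rule Least_equality)
    have "snd ((TPro G ^^ P) s) = snd s"
    proof -
      have "(snd s - 1 + P) mod card (pverts G) = (snd s - 1) mod card (pverts G)"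
        using P(2) by (auto simp: dvd_def)
      then show ?thesis
        using s unfolding snd_funpow_TPro[OF s] by (auto simp: states_def)
    qed
    then have "(TPro G ^^ P) s = s"
      using run[of P] rep s period[OF perm] by (intro represents_unique_state) auto
    then show "1 \<le> P \<and> (TPro G ^^ P) s = s"
      using P(1) by simp
  next
    fix L assume L: "1 \<le> L \<and> (TPro G ^^ L) s = s"
    then have "(stone_step (parcs G) ^^ L) xs = xs"
      using run[of L] rep s by (intro represents_unique_list[of s G]) auto
    then show "P \<le> L"
      using least[OF perm] L by blast
  qed
qed

section \<open>Trees as branches of the corona product\<close>

text \<open>Deleting \<open>r\<close> splits \<open>B\<close> into components. Acyclicity, stated as
  separation of neighbours, makes each contain a single neighbour of \<open>r\<close>; so they are
  disjoint and serve as the branches of the children. This form of acyclicity passes to subsets, as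
  the induction requires.\<close>

lemma branch_rooted_subtree:
  assumes "finite B" "sym E" "r \<in> B" "q \<notin> B" "(r, q) \<in> E"
    and closed: "\<And>x y. x \<in> B \<Longrightarrow> (x, y) \<in> E \<Longrightarrow> y \<in> B \<or> x = r \<and> y = q"
    and conn: "\<And>x. x \<in> B \<Longrightarrow> (r, x) \<in> (E \<inter> B \<times> B)\<^sup>*"
    and irrefl: "\<And>x. (x, x) \<notin> E"
    and acyc: "\<And>x c c'. x \<in> B \<Longrightarrow> c \<in> B \<Longrightarrow> c' \<in> B \<Longrightarrow> (x, c) \<in> E \<Longrightarrow> (x, c') \<in> E \<Longrightarrow>
      (c, c') \<in> (E \<inter> (B - {x}) \<times> (B - {x}))\<^sup>* \<Longrightarrow> c = c'"
  shows "branch E q r B"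
  using assms
proof (induction arbitrary: q r rule: finite_psubset_induct)
  case (psubset B)
  note prems = psubset.prems
  let ?R = "E \<inter> (B - {r}) \<times> (B - {r})"
  define C where "C = {c \<in> B. (r, c) \<in> E}"
  define D where "D c = {y. (c, y) \<in> ?R\<^sup>*}" for c
  have symR: "sym (?R\<^sup>*)"
    using prems(1) by (intro sym_rtrancl) (auto simp: sym_def)
  have C_sub: "c \<in> B - {r}" if "c \<in> C" for c
    using that prems(7) by (auto simp: C_def)
  have D_sub: "D c \<subseteq> B - {r}" if "c \<in> C" for c
  proof
    fix y assume "y \<in> D c"
    then have "(c, y) \<in> ?R\<^sup>*" by (simp add: D_def)
    then show "y \<in> B - {r}"
      by (induction rule: rtrancl_induct) (use C_sub[OF that] in auto)
  qed
  have child_unique: "c = c'" if "c \<in> C" "c' \<in> C" "(c, c') \<in> ?R\<^sup>*" for c c'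
    using that prems(2) prems(8)[of r c c'] by (auto simp: C_def)
  have branch_D: "branch E r c (D c)" if c: "c \<in> C" for c
  proof (rule psubset.IH)
    show "D c \<subset> B"
      using D_sub[OF c] prems(2) by auto
    show "c \<in> D c" by (simp add: D_def)
    show "r \<notin> D c" using D_sub[OF c] by auto
    show "(c, r) \<in> E" using c prems(1) by (auto simp: C_def dest: symD)
    \<comment> \<open>An edge can leave the component only to \<open>r\<close>; its other end is
      then a child of \<open>r\<close> connected to \<open>c\<close>, hence \<open>c\<close>
      itself.\<close>
    show "y \<in> D c \<or> x = c \<and> y = r" if x: "x \<in> D c" and xy: "(x, y) \<in> E" for x y
    proof (cases "y = r")
      case True
      then have "x \<in> C"
        using xy x D_sub[OF c] prems(1) by (auto simp: C_def dest: symD)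
      then have "c = x"
        using child_unique c x by (simp add: D_def)
      with True show ?thesis by simp
    next
      case False
      then have "(x, y) \<in> ?R"
        using prems(5)[OF _ xy] x D_sub[OF c] xy by auto
      then show ?thesis
        using x by (auto simp: D_def intro: rtrancl_into_rtrancl)
    qed
    show "(c, x) \<in> (E \<inter> D c \<times> D c)\<^sup>*" if "x \<in> D c" for x
    proof -
      have "(c, x) \<in> ?R\<^sup>*" using that by (simp add: D_def)
      then show ?thesis
      proof (induction rule: rtrancl_induct)
        case (step y z)
        then have "y \<in> D c" "z \<in> D c"
          by (auto simp: D_def intro: rtrancl_into_rtrancl)
        with step show ?case
          by (auto intro: rtrancl_into_rtrancl)
      qed simp
    qed
    show "a = a'" if "x \<in> D c" "a \<in> D c" "a' \<in> D c" "(x, a) \<in> E" "(x, a') \<in> E"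
      "(a, a') \<in> (E \<inter> (D c - {x}) \<times> (D c - {x}))\<^sup>*" for x a a'
    proof (rule prems(8))
      show "(a, a') \<in> (E \<inter> (B - {x}) \<times> (B - {x}))\<^sup>*"
        using that(6) by (rule rtrancl_mono[THEN subsetD, rotated]) (use D_sub[OF c] in auto)
    qed (use that D_sub[OF c] in auto)
  qed (use prems in auto)
  have "B = insert r (\<Union>c\<in>C. D c)"
  proof
    show "insert r (\<Union>c\<in>C. D c) \<subseteq> B"
      using D_sub prems(2) by auto
    show "B \<subseteq> insert r (\<Union>c\<in>C. D c)"
    proof
      fix x assume "x \<in> B"
      then have "(r, x) \<in> (E \<inter> B \<times> B)\<^sup>*" by (rule prems(6))
      then show "x \<in> insert r (\<Union>c\<in>C. D c)"
      proof (induction rule: rtrancl_induct)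
        case (step y z)
        consider "z = r" | "z \<noteq> r" "y = r" | c where "z \<noteq> r" "c \<in> C" "y \<in> D c"
          using step.IH by auto
        then show ?case
        proof cases
          case 2
          then have "z \<in> C" using step.hyps by (auto simp: C_def)
          then show ?thesis by (auto simp: D_def)
        next
          case 3
          then have "(y, z) \<in> ?R" using step.hyps D_sub by auto
          then have "z \<in> D c" using 3 by (auto simp: D_def intro: rtrancl_into_rtrancl)
          then show ?thesis using 3 by auto
        qed simp
      qed simp
    qed
  qed
  moreover have "branch E q r (insert r (\<Union>c\<in>C. D c))"
  proof (rule branchI)
    show "finite C" using psubset.hyps by (simp add: C_def)
    show "q \<notin> C" using prems(3) by (simp add: C_def)
    show "(r, x) \<in> E \<longleftrightarrow> x = q \<or> x \<in> C" for x
      using prems(2,4) prems(5)[of r x] by (auto simp: C_def)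
    show "disjoint_family_on D C"
      unfolding disjoint_family_on_def
    proof (intro ballI impI)
      fix c c' assume c: "c \<in> C" "c' \<in> C" "c \<noteq> c'"
      have False if "y \<in> D c" "y \<in> D c'" for y
      proof -
        have "(c, c') \<in> ?R\<^sup>*"
          using that symR by (auto simp: D_def dest: symD intro: rtrancl_trans)
        then show False using child_unique c by blast
      qed
      then show "D c \<inter> D c' = {}" by blast
    qed
    show "r \<notin> (\<Union>c\<in>C. D c)" using D_sub by auto
  qed (rule branch_D)
  ultimately show ?case by simp
qed

lemma rtrancl_map:
  assumes "\<And>a b. (a, b) \<in> R \<Longrightarrow> (f a, f b) \<in> S" "(a, b) \<in> R\<^sup>*"
  shows "(f a, f b) \<in> S\<^sup>*"
  using assms(2) by (induction rule: rtrancl_induct) (auto intro: assms(1) rtrancl_into_rtrancl)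

text \<open>A simple path from \<open>c\<close> to another neighbour \<open>c'\<close> that avoids
  \<open>z\<close> would close up through \<open>z\<close> to a cycle with at least three
  arcs.\<close>

lemma tree_graph_neighbours_separated:
  assumes T: "tree_graph T" and arcs: "(z, c) \<in> parcs T" "(z, c') \<in> parcs T"
    and path: "(c, c') \<in> (parcs T \<inter> (- {z}) \<times> (- {z}))\<^sup>*"
  shows "c = c'"
proof (rule ccontr)
  assume "c \<noteq> c'"
  interpret T: pair_graph T using T by (simp add: tree_graph_def)
  \<comment> \<open>Reachability in the graph without \<open>z\<close> yields a path with distinct
    vertices, none of them \<open>z\<close>.\<close>
  define H where "H = \<lparr>pverts = pverts T - {z}, parcs = parcs T \<inter> (- {z}) \<times> (- {z})\<rparr>"
  interpret H: pair_wf_digraph H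
    by unfold_locales (auto simp: H_def T.arc_fst_in_verts T.arc_snd_in_verts dest: T.in_arcsD1 T.in_arcsD2)
  have "c \<in> pverts H"
    using arcs(1) T.pair_no_loops[OF arcs(1)] by (auto simp: H_def dest: T.in_arcsD2)
  then have "c \<rightarrow>\<^sup>*\<^bsub>with_proj H\<^esub> c'"
    using path \<open>c \<noteq> c'\<close> H.reachable1_reachable[of c c'] by (auto simp: H_def rtrancl_eq_or_trancl)
  then obtain p where p: "H.apath c p c'"
    using H.reachable_apath by blast
  then have walk: "H.awalk c p c'" and dist: "distinct (pawalk_verts c p)"
    by (simp_all add: H.apath_def)
  have cas: "pcas c p c'" and set_p: "set p \<subseteq> parcs T"
    using walk unfolding H.awalk_def by (auto simp: H_def)
  have "set (pawalk_verts c p) \<subseteq> pverts H"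
    using walk H.awalk_verts_in_verts unfolding H.awalk_def by blast
  then have verts: "z \<notin> set (pawalk_verts c p)"
    by (auto simp: H_def)
  have "(c', z) \<in> parcs T"
    using arcs(2) T.arcs_symmetric by simp
  let ?cyc = "(z, c) # p @ [(c', z)]"
  have "pcas u (p @ [(c', z)]) z \<and> pawalk_verts u (p @ [(c', z)]) = pawalk_verts u p @ [z]"
    if "pcas u p c'" for u
    using that by (induction p arbitrary: u) auto
  from this[OF cas] have "pcas z ?cyc z" "distinct (tl (pawalk_verts z ?cyc))"
    using dist verts by auto
  moreover have "set ?cyc \<subseteq> parcs T" "z \<in> pverts T"
    using set_p arcs(1) \<open>(c', z) \<in> parcs T\<close> by (auto dest: T.in_arcsD1)
  ultimately have "T.cycle ?cyc"
    unfolding T.cycle_def T.awalk_def by blast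
  moreover have "3 \<le> length ?cyc"
    using cas \<open>c \<noteq> c'\<close> by (cases p) auto
  ultimately show False
    using T unfolding tree_graph_def by blast
qed

lemma tree_graph_connected:
  assumes "tree_graph T" "u \<in> pverts T" "v \<in> pverts T"
  shows "(u, v) \<in> (parcs T)\<^sup>*"
proof -
  interpret T: pair_graph T using assms(1) by (simp add: tree_graph_def)
  have "u \<rightarrow>\<^sup>*\<^bsub>with_proj T\<^esub> v"
    using assms T.reachable_mk_symmetric_eq
    by (auto simp: tree_graph_def connected_def strongly_connected_def T.sym_arcs)
  then show ?thesis
    by (auto dest: reachable_rtranclI)
qed

text \<open>Connectivity is carried from the tree into its copy along \<open>?in\<close>, and the
  separation of neighbours is pulled back along \<open>?out\<close>.\<close>

lemma branch_corona:
  fixes G :: "'a pair_pre_digraph" and T :: "'b pair_pre_digraph"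
  assumes T: "tree_graph T" and v: "v \<in> pverts T" and G: "pair_graph G" and x: "x \<in> pverts G"
  shows "branch (parcs (corona G T v)) (Inl x) (Inr (x, v)) (Inr ` ({x} \<times> pverts T))"
proof -
  interpret T: pair_graph T using T by (simp add: tree_graph_def)
  interpret Co: pair_graph "corona G T v"
    using G T v by (intro pair_graph_corona) (simp_all add: tree_graph_def)
  let ?E = "parcs (corona G T v)" and ?B = "Inr ` ({x} \<times> pverts T) :: ('a + 'a \<times> 'b) set"
  let ?in = "\<lambda>u. Inr (x, u) :: 'a + 'a \<times> 'b" and ?out = "\<lambda>y :: 'a + 'a \<times> 'b. snd (projr y)"
  show ?thesis
  proof (rule branch_rooted_subtree)
    show "finite ?B" using T.pair_finite_verts by simp
    show "sym ?E" using Co.pair_sym_arcs by (simp add: symmetric_def)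
    show "(y, y) \<notin> ?E" for y using Co.pair_no_loops[of "(y, y)"] by auto
    show "z \<in> ?B \<or> y = ?in v \<and> z = Inl x" if "y \<in> ?B" "(y, z) \<in> ?E" for y z
      using that by (auto simp: corona_def dest: T.in_arcsD2)
    show "(?in v, y) \<in> (?E \<inter> ?B \<times> ?B)\<^sup>*" if "y \<in> ?B" for y
    proof -
      obtain u where u: "y = ?in u" "u \<in> pverts T" using \<open>y \<in> ?B\<close> by auto
      have "(a, b) \<in> parcs T \<Longrightarrow> (?in a, ?in b) \<in> ?E \<inter> ?B \<times> ?B" for a b
        using x by (auto simp: corona_def dest: T.in_arcsD1 T.in_arcsD2)
      then show ?thesis
        unfolding u(1) using tree_graph_connected[OF T v u(2)] by (rule rtrancl_map)
    qed
    show "c = c'" if y: "y \<in> ?B" and c: "c \<in> ?B" "c' \<in> ?B" "(y, c) \<in> ?E" "(y, c') \<in> ?E"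
      and path: "(c, c') \<in> (?E \<inter> (?B - {y}) \<times> (?B - {y}))\<^sup>*" for y c c'
    proof -
      let ?z = "?out y"
      have "(?out a, ?out b) \<in> parcs T \<inter> (- {?z}) \<times> (- {?z})"
        if "(a, b) \<in> ?E \<inter> (?B - {y}) \<times> (?B - {y})" for a b
        using that y by (auto simp: corona_def)
      then have "(?out c, ?out c') \<in> (parcs T \<inter> (- {?z}) \<times> (- {?z}))\<^sup>*"
        using path by (rule rtrancl_map)
      moreover have "(?z, ?out c) \<in> parcs T" "(?z, ?out c') \<in> parcs T"
        using y c by (auto simp: corona_def)
      ultimately have "?out c = ?out c'"
        using tree_graph_neighbours_separated[OF T] by blast
      then show ?thesis using c by auto
    qed
  qed (use v x in \<open>auto simp: corona_def\<close>)
qed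

theorem theorem10:
  fixes m n :: nat
    and T :: "'b pair_pre_digraph" and v' :: 'b
    and K :: "'a pair_pre_digraph"
  assumes "1 \<le> m" and "1 \<le> n"
    and "tree_graph T" and "card (pverts T) = m" and "v' \<in> pverts T"
    and "complete_digraph n (with_proj K)"
  shows "\<forall>s \<in> states (corona K T v').
           orbit_length (TPro (corona K T v')) s = (n * m + n) * (n * m + n - 1)"
proof
  fix s assume s: "s \<in> states (corona K T v')"
  have K: "finite (pverts K)" "card (pverts K) = n"
    "parcs K = {(x, y). x \<in> pverts K \<and> y \<in> pverts K \<and> x \<noteq> y}"
    using assms(6) by (auto simp: complete_digraph_pair_def)
  have pair_K: "pair_graph K"
    using assms(6) by (rule pair_graphI_complete)
  interpret Co: pair_graph "corona K T v'"
    using assms pair_K by (intro pair_graph_corona) (simp_all add: tree_graph_def)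
  have finT: "finite (pverts T)"
    using assms(1,4) by (auto intro: card_ge_0_finite)
  have card_Inl: "card (Inl ` pverts K :: ('a + 'a \<times> 'b) set) = n"
    by (simp add: card_image K)
  interpret core_branches "parcs (corona K T v')" "pverts (corona K T v')" "Inl ` pverts K"
    "\<lambda>y. Inr (projl y, v')" "\<lambda>y. Inr ` ({projl y} \<times> pverts T)" m
  proof
    show "finite (pverts (corona K T v'))" by (rule Co.pair_finite_verts)
    show "sym (parcs (corona K T v'))" using Co.pair_sym_arcs by (simp add: symmetric_def)
    show "Inl ` pverts K \<noteq> ({} :: ('a + 'a \<times> 'b) set)" using K(2) assms(2) by auto
    show "branch (parcs (corona K T v')) x (Inr (projl x, v')) (Inr ` ({projl x} \<times> pverts T))"
      if "x \<in> Inl ` pverts K" for x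
      using that branch_corona[OF assms(3,5) pair_K] by auto
    show "card (Inr ` ({projl x} \<times> pverts T) :: ('a + 'a \<times> 'b) set) = m"
      for x :: "'a + 'a \<times> 'b"
      using assms(4) by (simp add: card_image card_cartesian_product)
    show "card (pverts (corona K T v'))
        = card (Inl ` pverts K :: ('a + 'a \<times> 'b) set) * m + card (Inl ` pverts K :: ('a + 'a \<times> 'b) set)"
      using K(1,2) finT assms(4) by (simp add: card_Inl card_corona)
  qed (use assms(1) in \<open>auto simp: corona_def K(3)\<close>)
  have card_Co: "card (pverts (corona K T v')) = n * m + n"
    using K(1,2) finT assms(4) by (simp add: card_corona)
  show "orbit_length (TPro (corona K T v')) s = (n * m + n) * (n * m + n - 1)"
    unfolding card_Co[symmetric]
    using s card_V_ge stone_step_least_period by (intro orbit_length_TPro) auto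
qed

end
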